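(* Let $\mu_1,\dots,\mu_r$ be a system of $r$ bidimensional measures (measures on $\mathbb{R}^2$) and let $\vec n=(n_1,\dots,n_r)\in\mathbb{N}^r$ be a multi-index. The following statements are equivalent: (1) there exist unique bivariate Type I multiple orthogonal polynomials $A_{\vec n,1},\dots,A_{\vec n,r}$ associated to $\vec n$; (2) there exists a unique bivariate Type II multiple orthogonal polynomial $P_{\vec n}$ associated to $\vec n$; (3) the $|\vec n|\times|\vec n|$ block moment matrix $M_{\vec n}=\left(M^{(1)}_{n_1}\,|\,\cdots\,|\,M^{(r)}_{n_r}\right)$ is regular (invertible).
   Context: Here $\mathbb{N}=\{0,1,2,\dots\}$ and $|\vec n|=n_1+\dots+n_r$. All measures are assumed to have finite moments $m^{(j)}_{(t,s)}=\int_{\mathbb{R}^2}x^ty^s\,d\mu_j(x,y)$, and $\langle f,g\rangle_j=\int fg\,d\mu_j$. The Cantor pairing function is the bijection $\pi:\mathbb{N}^2\to\mathbb{N}$, $\pi(t,s)=\frac12(t+s)(t+s+1)+s$. It gives the position (starting at $0$) of $x^ty^s$ in the ordered list of monomials $1,x,y,x^2,xy,y^2,x^3,x^2y,xy^2,y^3,\dots$. Type II: let $(l,m)=\pi^{-1}(|\vec n|)$. A bivariate Type II multiple orthogonal polynomial associated to $\vec n$ is a monic polynomial $P_{\vec n}(x,y)=x^ly^m+\sum_{k=0}^{|\vec n|-1}c_k\,e_k(x,y)$, where $e_k(x,y)=x^ty^s$ with $(t,s)=\pi^{-1}(k)$, such that $\langle P_{\vec n},x^ty^s\rangle_j=0$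 whenever $0\le\pi(t,s)\le n_j-1$, for $j=1,\dots,r$. Type I: bivariate Type I multiple orthogonal polynomials associated to $\vec n$ are $r$ polynomials $A_{\vec n,j}=\sum_{k=0}^{n_j-1}c_{k,j}\,e_k(x,y)$, $j=1,\dots,r$ (so $A_{\vec n,j}$ is a linear combination of the first $n_j$ monomials in the list, and is $0$ if $n_j=0$), such that $\sum_{j=1}^r\langle A_{\vec n,j},x^ty^s\rangle_j$ equals $0$ if $0\le\pi(t,s)\le|\vec n|-2$ and equals $1$ if $\pi(t,s)=|\vec n|-1$. Moment matrix: for each $j$, $M^{(j)}_{n_j}$ is the $|\vec n|\times n_j$ matrix whose entry in row $k$ and column $l$ (counting from $0$) is $m^{(j)}_{\pi^{-1}(k)+\pi^{-1}(l)}$, $k=0,\dots,|\vec n|-1$, $l=0,\dots,n_j-1$, where the sum of pairs is componentwise. *)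

theory Defs
  imports
    "HOL-Analysis.Analysis"
    "HOL-Computational_Algebra.Polynomial"
    "HOL-Library.FuncSet"
    "HOL-Library.Nat_Bijection"
    "Jordan_Normal_Form.Matrix"
begin

definition cantor_pair :: "nat \<times> nat \<Rightarrow> nat" where
  "cantor_pair = (\<lambda>(t, s). ((t + s) * (t + s + 1)) div 2 + s)"

text \<open>The library's pairing function adds the first component rather than the second.\<close>

lemma cantor_pair_prod_encode: "cantor_pair (t, s) = prod_encode (s, t)"
  by (simp add: cantor_pair_def prod_encode_def triangle_def add.commute)

lemma bij_cantor_pair: "bij cantor_pair"
proof -
  have "cantor_pair = prod_encode \<circ> prod.swap"
    by (auto simp: fun_eq_iff cantor_pair_prod_encode)
  then show ?thesis
    using bij_comp[OF bij_swap bij_prod_encode] by simp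
qed

definition cantor_unpair :: "nat \<Rightarrow> nat \<times> nat" where
  "cantor_unpair = inv_into UNIV cantor_pair"

text \<open>
  Bivariate polynomials are elements of \<open>\<real>[x][y]\<close>: the outer variable is \<open>y\<close>, and the
  coefficients are polynomials in \<open>x\<close>.
\<close>

type_synonym bipoly = "real poly poly"

definition xy_monom :: "nat \<times> nat \<Rightarrow> bipoly" where
  "xy_monom = (\<lambda>(t, s). monom (monom 1 t) s)"

definition eval2 :: "bipoly \<Rightarrow> real \<times> real \<Rightarrow> real" where
  "eval2 p = (\<lambda>(x, y). poly (poly p [:y:]) x)"

lemma eval2_xy_monom: "eval2 (xy_monom (t, s)) (x, y) = x ^ t * y ^ s"
  by (simp add: eval2_def xy_monom_def poly_monom poly_power)

definition lincomb_monoms :: "(nat \<Rightarrow> real) \<Rightarrow> nat \<Rightarrow> bipoly" where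
  "lincomb_monoms c N = (\<Sum>k<N. Polynomial.smult [:c k:] (xy_monom (cantor_unpair k)))"

definition moment :: "(real \<times> real) measure \<Rightarrow> nat \<times> nat \<Rightarrow> real" where
  "moment M = (\<lambda>(t, s). LINT (x, y)|M. x ^ t * y ^ s)"

definition finite_moments :: "(real \<times> real) measure \<Rightarrow> bool" where
  "finite_moments M \<longleftrightarrow> (\<forall>t s. integrable M (\<lambda>(x, y). x ^ t * y ^ s))"

definition inner_prod :: "(real \<times> real) measure \<Rightarrow> bipoly \<Rightarrow> bipoly \<Rightarrow> real" where
  "inner_prod M f g = (LINT z|M. eval2 f z * eval2 g z)"

text \<open>
  Multi-indices and systems of measures are indexed by \<open>{1..r}\<close>; their values outside this
  range are irrelevant.
\<close>

definition index_norm :: "nat \<Rightarrow> (nat \<Rightarrow> nat) \<Rightarrow> nat" where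
  "index_norm r n = (\<Sum>j=1..r. n j)"

text \<open>
  Upper bounds such as \<open>\<pi>(t, s) \<le> |n| - 2\<close> are to be read over the integers, where they are
  unsatisfiable for small \<open>|n|\<close>. They are therefore stated below without truncating subtraction.
\<close>

definition is_type_II ::
  "nat \<Rightarrow> (nat \<Rightarrow> (real \<times> real) measure) \<Rightarrow> (nat \<Rightarrow> nat) \<Rightarrow> bipoly \<Rightarrow> bool" where
  "is_type_II r \<mu> n P \<longleftrightarrow>
     (\<exists>c. P = xy_monom (cantor_unpair (index_norm r n)) + lincomb_monoms c (index_norm r n)) \<and>
     (\<forall>j\<in>{1..r}. \<forall>t s. cantor_pair (t, s) < n j \<longrightarrow> inner_prod (\<mu> j) P (xy_monom (t, s)) = 0)"

text \<open>
  A Type I family is an \<open>r\<close>-tuple, so it is required to be \<open>extensional\<close> on \<open>{1..r}\<close>;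
  otherwise uniqueness would fail because of the values outside this range.
\<close>

definition is_type_I ::
  "nat \<Rightarrow> (nat \<Rightarrow> (real \<times> real) measure) \<Rightarrow> (nat \<Rightarrow> nat) \<Rightarrow> (nat \<Rightarrow> bipoly) \<Rightarrow> bool" where
  "is_type_I r \<mu> n A \<longleftrightarrow>
     A \<in> extensional {1..r} \<and>
     (\<forall>j\<in>{1..r}. \<exists>c. A j = lincomb_monoms c (n j)) \<and>
     (\<forall>t s.
        (cantor_pair (t, s) + 2 \<le> index_norm r n \<longrightarrow>
           (\<Sum>j=1..r. inner_prod (\<mu> j) (A j) (xy_monom (t, s))) = 0) \<and>
        (cantor_pair (t, s) + 1 = index_norm r n \<longrightarrow>
           (\<Sum>j=1..r. inner_prod (\<mu> j) (A j) (xy_monom (t, s))) = 1))"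

definition moment_matrix :: "(real \<times> real) measure \<Rightarrow> nat \<Rightarrow> nat \<Rightarrow> real mat" where
  "moment_matrix M N n =
     Matrix.mat N n (\<lambda>(k, l). moment M (cantor_unpair k + cantor_unpair l))"

definition block_moment_matrix ::
  "nat \<Rightarrow> (nat \<Rightarrow> (real \<times> real) measure) \<Rightarrow> (nat \<Rightarrow> nat) \<Rightarrow> real mat" where
  "block_moment_matrix r \<mu> n =
     mat_of_cols (index_norm r n)
       (concat (map (\<lambda>j. cols (moment_matrix (\<mu> j) (index_norm r n) (n j))) [1..<Suc r]))"

lemma block_moment_matrix_carrier:
  "block_moment_matrix r \<mu> n \<in> carrier_mat (index_norm r n) (index_norm r n)"
proof -
  have "length (concat (map (\<lambda>j. cols (moment_matrix (\<mu> j) N (n j))) [1..<Suc r]))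
      = index_norm r n" for N
    by (induction r) (simp_all add: index_norm_def moment_matrix_def)
  then show ?thesis
    unfolding block_moment_matrix_def by (intro carrier_matI) simp_all
qed

end

theory Submission
  imports Defs "Jordan_Normal_Form.Determinant"
begin

text \<open>
  Both orthogonality problems are square linear systems governed by the block moment matrix
  \<open>M\<close> of size \<open>N = |n|\<close>, one through its columns and one through its rows. Write
  \<open>m\<^sub>j\<close> for the moments of \<open>\<mu> j\<close>.

  If \<open>P\<close> has the monic leading monomial at position \<open>N\<close> and lower coefficients \<open>c\<close>, then the
  inner product of \<open>P\<close> with the monomial at position \<open>l\<close> with respect to \<open>\<mu> j\<close> is the product of
  \<open>c\<close> with the column \<open>l\<close> of the block \<open>j\<close>, plus a moment from the leading term. Hence \<open>P\<close> is of
  Type II iff \<open>c\<close> solves a system with matrix \<open>M\<^sup>T\<close>. If instead the coefficients of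
  \<open>A 1, \<dots>, A r\<close> are strung together into one vector \<open>a\<close>, then the sum over \<open>j\<close> of the inner
  products with the monomial at position \<open>k\<close> is the entry \<open>k\<close> of the product \<open>M a\<close>. Hence the
  family is of Type I iff \<open>M a\<close> is the last unit vector. Since monomials are linearly independent
  (\<open>lincomb_monoms_eq_iff\<close>), polynomials and coefficient vectors determine each other, so unique
  existence carries over. Finally, a square system has exactly one solution iff its matrix is
  regular, whatever the right-hand side (\<open>invertible_mat_iff_unique_solution\<close>), and \<open>M\<close> and
  \<open>M\<^sup>T\<close> are regular simultaneously.
\<close>

\<comment> \<open>The notation \<open>x $ i\<close> stands for the entries of vectors of variable length throughout.\<close>
unbundle no vec_syntax

section \<open>Regular matrices and uniquely solvable systems\<close>

lemma invertible_mat_iff_trivial_kernel: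
  fixes A :: "'a :: field mat"
  assumes A: "A \<in> carrier_mat N N"
  shows "invertible_mat A \<longleftrightarrow> (\<forall>v \<in> carrier_vec N. A *\<^sub>v v = 0\<^sub>v N \<longrightarrow> v = 0\<^sub>v N)"
proof
  assume "invertible_mat A"
  then obtain B where "A * B = 1\<^sub>m N" and BA: "B * A = 1\<^sub>m (dim_row B)"
    using A by (auto simp: invertible_mat_def inverts_mat_def)
  then have B: "B \<in> carrier_mat N N"
    using A by (metis carrier_matD(2) carrier_matI index_mult_mat(3) index_one_mat(3))
  show "\<forall>v \<in> carrier_vec N. A *\<^sub>v v = 0\<^sub>v N \<longrightarrow> v = 0\<^sub>v N"
  proof (intro ballI impI)
    fix v :: "'a Matrix.vec" assume v: "v \<in> carrier_vec N" and "A *\<^sub>v v = 0\<^sub>v N"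
    then have "(B * A) *\<^sub>v v = 0\<^sub>v N"
      using B by (auto simp: assoc_mult_mat_vec[OF B A v] intro!: eq_vecI)
    then show "v = 0\<^sub>v N"
      using BA B v by simp
  qed
next
  assume "\<forall>v \<in> carrier_vec N. A *\<^sub>v v = 0\<^sub>v N \<longrightarrow> v = 0\<^sub>v N"
  then have "Determinant.det A \<noteq> 0"
    using det_0_iff_vec_prod_zero_field[OF A] by blast
  then have "A \<in> Units (ring_mat TYPE('a) N ())"
    by (rule det_non_zero_imp_unit[OF A])
  then obtain B where "B \<in> carrier_mat N N" "B * A = 1\<^sub>m N" "A * B = 1\<^sub>m N"
    by (auto simp: Units_def ring_mat_def)
  then show "invertible_mat A"
    using A by (auto simp: invertible_mat_def inverts_mat_def)
qed

text \<open>
  The solutions of a solvable system form a coset of the kernel, so uniqueness for one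
  right-hand side already forces the kernel to be trivial. The right-hand side may therefore be
  arbitrary, in particular zero.
\<close>

lemma invertible_mat_iff_unique_solution:
  fixes A :: "'a :: field mat"
  assumes A: "A \<in> carrier_mat N N" and b: "b \<in> carrier_vec N"
  shows "invertible_mat A \<longleftrightarrow> (\<exists>!x. x \<in> carrier_vec N \<and> A *\<^sub>v x = b)"
proof
  assume inv: "invertible_mat A"
  then obtain B where AB: "A * B = 1\<^sub>m N" and "B * A = 1\<^sub>m (dim_row B)"
    using A by (auto simp: invertible_mat_def inverts_mat_def)
  then have B: "B \<in> carrier_mat N N" and BA: "B * A = 1\<^sub>m N"
    using A by (metis carrier_matD(2) carrier_matI index_mult_mat(3) index_one_mat(3))+
  show "\<exists>!x. x \<in> carrier_vec N \<and> A *\<^sub>v x = b"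
  proof (rule ex1I)
    have "A *\<^sub>v (B *\<^sub>v b) = b"
      using AB b by (simp flip: assoc_mult_mat_vec[OF A B b])
    then show "B *\<^sub>v b \<in> carrier_vec N \<and> A *\<^sub>v (B *\<^sub>v b) = b"
      using B b by simp
  next
    fix x assume x: "x \<in> carrier_vec N \<and> A *\<^sub>v x = b"
    then have "B *\<^sub>v b = (B * A) *\<^sub>v x"
      using assoc_mult_mat_vec[OF B A, of x] by simp
    then show "x = B *\<^sub>v b"
      using BA x by simp
  qed
next
  assume "\<exists>!x. x \<in> carrier_vec N \<and> A *\<^sub>v x = b"
  then obtain x where x: "x \<in> carrier_vec N" "A *\<^sub>v x = b"
    and uniq: "\<And>y. y \<in> carrier_vec N \<Longrightarrow> A *\<^sub>v y = b \<Longrightarrow> y = x"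
    by blast
  show "invertible_mat A"
    unfolding invertible_mat_iff_trivial_kernel[OF A]
  proof (intro ballI impI)
    fix v assume v: "v \<in> carrier_vec N" and "A *\<^sub>v v = 0\<^sub>v N"
    then have "A *\<^sub>v (x + v) = b"
      using mult_add_distrib_mat_vec[OF A x(1) v] x b by simp
    then have "x + v = x"
      using uniq[of "x + v"] x v by simp
    then show "v = 0\<^sub>v N"
      using x(1) v by (auto simp: Matrix.vec_eq_iff)
  qed
qed

lemma invertible_mat_transpose_iff:
  fixes A :: "'a :: field mat"
  assumes A: "A \<in> carrier_mat N N"
  shows "invertible_mat (transpose_mat A) \<longleftrightarrow> invertible_mat A"
proof -
  have "invertible_mat C \<longleftrightarrow> Determinant.det C \<noteq> 0" if "C \<in> carrier_mat N N" for C :: "'a mat"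
    unfolding invertible_mat_iff_trivial_kernel[OF that] det_0_iff_vec_prod_zero_field[OF that]
    by blast
  then show ?thesis
    using A by (simp add: det_transpose[OF A])
qed

text \<open>
  Used to translate unique existence of polynomials into unique existence of coefficient vectors.
\<close>

lemma ex1_iff_ex1_parameter:
  assumes inj: "inj_on F S" and Q: "\<And>P. Q P \<longleftrightarrow> (\<exists>x\<in>S. P = F x \<and> R x)"
  shows "(\<exists>!P. Q P) \<longleftrightarrow> (\<exists>!x. x \<in> S \<and> R x)"
proof
  assume "\<exists>!P. Q P"
  then obtain P where "Q P" and uniq: "\<And>P'. Q P' \<Longrightarrow> P' = P"
    by blast
  then obtain x where x: "x \<in> S" "R x" "P = F x"
    unfolding Q by blast
  have "y = x" if "y \<in> S" "R y" for y
  proof -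
    have "F y = F x"
      using uniq[of "F y"] that x by (auto simp: Q)
    then show ?thesis
      using inj that x by (auto dest: inj_onD)
  qed
  then show "\<exists>!x. x \<in> S \<and> R x"
    using x by blast
next
  assume "\<exists>!x. x \<in> S \<and> R x"
  then show "\<exists>!P. Q P"
    unfolding Q by blast
qed

section \<open>Monomial combinations and their moments\<close>

lemma cantor_pair_unpair [simp]: "cantor_pair (cantor_unpair k) = k"
  using bij_cantor_pair by (simp add: cantor_unpair_def bij_is_surj surj_f_inv_f)

lemma cantor_unpair_pair [simp]: "cantor_unpair (cantor_pair z) = z"
  using bij_cantor_pair by (simp add: cantor_unpair_def bij_is_inj inv_f_f)

lemma all_pairs_iff_all_positions:
  "(\<forall>t s. Q (cantor_pair (t, s)) (t, s)) \<longleftrightarrow> (\<forall>k. Q k (cantor_unpair k))"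
  by (metis cantor_pair_unpair cantor_unpair_pair surj_pair)

text \<open>
  Distinct positions carry distinct monomials, so each coefficient of the combination receives at
  most one contribution. This is the linear independence of the monomials.
\<close>

lemma coeff_lincomb_monoms:
  "poly.coeff (poly.coeff (lincomb_monoms c N) s) t =
    (if cantor_pair (t, s) < N then c (cantor_pair (t, s)) else 0)"
proof -
  have "poly.coeff (poly.coeff (Polynomial.smult [:a:] (xy_monom z)) s) t = (if z = (t, s) then a else 0)"
    for a z
    by (cases z) (auto simp: xy_monom_def)
  then have "poly.coeff (poly.coeff (lincomb_monoms c N) s) t =
      (\<Sum>k<N. if cantor_unpair k = (t, s) then c k else 0)"
    by (simp add: lincomb_monoms_def coeff_sum)
  also have "\<dots> = (\<Sum>k<N. if k = cantor_pair (t, s) then c k else 0)"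
    by (intro sum.cong refl) (metis cantor_pair_unpair cantor_unpair_pair)
  finally show ?thesis
    by (simp add: if_distrib)
qed

lemma lincomb_monoms_eq_iff: "lincomb_monoms c N = lincomb_monoms d N \<longleftrightarrow> (\<forall>k<N. c k = d k)"
proof
  assume eq: "lincomb_monoms c N = lincomb_monoms d N"
  show "\<forall>k<N. c k = d k"
  proof (intro allI impI)
    fix k assume "k < N"
    moreover obtain t s where "cantor_unpair k = (t, s)"
      by fastforce
    then have "cantor_pair (t, s) = k"
      by (metis cantor_pair_unpair)
    ultimately show "c k = d k"
      using coeff_lincomb_monoms[of c N s t] coeff_lincomb_monoms[of d N s t] eq by simp
  qed
qed (simp add: lincomb_monoms_def)

text \<open>
  This absorbs the leading term into the combination, so that one moment formula serves both types.
\<close>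

lemma monic_lincomb_monoms:
  "xy_monom (cantor_unpair N) + lincomb_monoms c N = lincomb_monoms (c(N := 1)) (Suc N)"
  by (simp add: lincomb_monoms_def one_pCons[symmetric] add.commute)

lemma eval2_lincomb_monoms:
  "eval2 (lincomb_monoms c N) z = (\<Sum>k<N. c k * eval2 (xy_monom (cantor_unpair k)) z)"
  by (cases z) (simp add: lincomb_monoms_def eval2_def poly_sum)

lemma eval2_xy_monom_mult:
  "eval2 (xy_monom a) z * eval2 (xy_monom b) z = eval2 (xy_monom (a + b)) z"
  by (cases a; cases b; cases z) (simp add: eval2_xy_monom power_add)

lemma eval2_xy_monom_eq: "eval2 (xy_monom (t, s)) = (\<lambda>(x, y). x ^ t * y ^ s)"
  by (auto simp: eval2_xy_monom)

text \<open>
  The product of two monomials is the monomial of the added exponents, so inner products expand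
  into moments. Finiteness of the moments is what permits exchanging the integral with the sum.
\<close>

lemma inner_prod_lincomb_monoms:
  assumes "finite_moments M"
  shows "inner_prod M (lincomb_monoms c N) (xy_monom a) =
    (\<Sum>k<N. c k * moment M (cantor_unpair k + a))"
proof -
  have int: "integrable M (eval2 (xy_monom b))" for b
    using assms by (cases b) (simp add: finite_moments_def eval2_xy_monom_eq)
  have mom: "moment M b = integral\<^sup>L M (eval2 (xy_monom b))" for b
    by (cases b) (simp add: moment_def eval2_xy_monom_eq)
  have "inner_prod M (lincomb_monoms c N) (xy_monom a) =
      (LINT z|M. (\<Sum>k<N. c k * eval2 (xy_monom (cantor_unpair k + a)) z))"
    by (simp add: inner_prod_def eval2_lincomb_monoms sum_distrib_right mult.assoc eval2_xy_monom_mult)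
  also have "\<dots> = (\<Sum>k<N. c k * moment M (cantor_unpair k + a))"
    by (simp add: Bochner_Integration.integral_sum int mom)
  finally show ?thesis .
qed

section \<open>The columns of the block moment matrix\<close>

text \<open>
  The position \<open>i\<close> of a column corresponds to a pair \<open>q i = (j, l)\<close>, the column \<open>l\<close> of the block
  \<open>j\<close>. Stating this as an abstract bijection keeps offset arithmetic with the partial sums
  \<open>n 1 + \<dots> + n (j - 1)\<close> out of the later proofs, where sums and conditions over columns are simply
  reindexed by pairs.
\<close>

lemma block_moment_matrix_columns:
  obtains q where "bij_betw q {..<index_norm r n} (Sigma {1..r} (\<lambda>j. {..<n j}))"
    and "\<And>k i j l. k < index_norm r n \<Longrightarrow> i < index_norm r n \<Longrightarrow> q i = (j, l) \<Longrightarrow>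
      block_moment_matrix r \<mu> n $$ (k, i) = moment (\<mu> j) (cantor_unpair k + cantor_unpair l)"
proof -
  define N where "N = index_norm r n"
  define idx where "idx = concat (map (\<lambda>j. map (Pair j) [0..<n j]) [1..<Suc r])"
  define column where
    "column = (\<lambda>(j, l). Matrix.vec N (\<lambda>k. moment (\<mu> j) (cantor_unpair k + cantor_unpair l)))"
  have set_idx: "set idx = Sigma {1..r} (\<lambda>j. {..<n j})"
    by (auto simp: idx_def)
  have len: "length idx = N"
    unfolding idx_def N_def by (induction r) (simp_all add: index_norm_def)
  have "card (set idx) = N"
    by (simp add: set_idx N_def index_norm_def)
  then have "distinct idx"
    by (simp add: card_distinct len)
  then have bij: "bij_betw (nth idx) {..<N} (Sigma {1..r} (\<lambda>j. {..<n j}))"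
    using bij_betw_nth[of idx "{..<N}"] len set_idx by simp
  have "cols (moment_matrix (\<mu> j) N (n j)) = map column (map (Pair j) [0..<n j])" for j
    by (intro nth_equalityI) (auto simp: moment_matrix_def column_def)
  then have "concat (map (\<lambda>j. cols (moment_matrix (\<mu> j) N (n j))) [1..<Suc r]) = map column idx"
    by (simp add: idx_def map_concat comp_def)
  then have "block_moment_matrix r \<mu> n = mat_of_cols N (map column idx)"
    by (simp add: block_moment_matrix_def N_def)
  then have "block_moment_matrix r \<mu> n $$ (k, i) = moment (\<mu> j) (cantor_unpair k + cantor_unpair l)"
    if "k < N" "i < N" "idx ! i = (j, l)" for k i j l
    using that len by (simp add: mat_of_cols_index column_def)
  then show ?thesis
    using that[of "nth idx"] bij unfolding N_def by blast
qed

section \<open>The two linear systems\<close>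

text \<open>
  Each orthogonality condition belongs to one column \<open>(j, l)\<close> of \<open>M\<close>, hence to one row of
  \<open>M\<^sup>T\<close>. The contribution of the leading monomial is known, and moving it to the other side
  yields the right-hand side \<open>b\<close>.
\<close>

lemma type_II_unique_iff_regular:
  assumes fin: "\<And>j. j \<in> {1..r} \<Longrightarrow> finite_moments (\<mu> j)"
  shows "(\<exists>!P. is_type_II r \<mu> n P) \<longleftrightarrow> invertible_mat (block_moment_matrix r \<mu> n)"
proof -
  define N where "N = index_norm r n"
  define S where "S = Sigma {1..r} (\<lambda>j. {..<n j})"
  define M where "M = block_moment_matrix r \<mu> n"
  obtain q where q: "bij_betw q {..<N} S"
    and entry: "\<And>k i j l. k < N \<Longrightarrow> i < N \<Longrightarrow> q i = (j, l) \<Longrightarrow>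
      M $$ (k, i) = moment (\<mu> j) (cantor_unpair k + cantor_unpair l)"
    using block_moment_matrix_columns[of r n \<mu>] unfolding N_def S_def M_def by blast
  have M: "M \<in> carrier_mat N N"
    unfolding M_def N_def by (rule block_moment_matrix_carrier)
  define b where
    "b = Matrix.vec N (\<lambda>i. case q i of (j, l) \<Rightarrow> - moment (\<mu> j) (cantor_unpair N + cantor_unpair l))"
  have dim_b: "dim_vec b = N"
    by (simp add: b_def)
  define F where "F x = xy_monom (cantor_unpair N) + lincomb_monoms (\<lambda>k. x $ k) N"
    for x :: "real Matrix.vec"
  have inj: "inj_on F (carrier_vec N)"
    by (intro inj_onI eq_vecI) (auto simp: F_def lincomb_monoms_eq_iff)
  have orth: "inner_prod (\<mu> j) (F x) (xy_monom (cantor_unpair l)) =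
      (M\<^sup>T *\<^sub>v x) $ i - b $ i"
    if x: "x \<in> carrier_vec N" and i: "i < N" "q i = (j, l)" for x i j l
  proof -
    have "(j, l) \<in> S"
      using bij_betwE[OF q] i by (metis lessThan_iff)
    then have "inner_prod (\<mu> j) (F x) (xy_monom (cantor_unpair l)) =
        (\<Sum>k<N. x $ k * moment (\<mu> j) (cantor_unpair k + cantor_unpair l)) +
        moment (\<mu> j) (cantor_unpair N + cantor_unpair l)"
      by (simp add: F_def monic_lincomb_monoms inner_prod_lincomb_monoms fin S_def)
    moreover have "(M\<^sup>T *\<^sub>v x) $ i =
        (\<Sum>k<N. x $ k * moment (\<mu> j) (cantor_unpair k + cantor_unpair l))"
      using x i M by (auto simp: scalar_prod_def entry mult.commute atLeast0LessThan intro!: sum.cong)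
    ultimately show ?thesis
      using i by (simp add: b_def)
  qed
  have system: "(\<forall>j\<in>{1..r}. \<forall>t s. cantor_pair (t, s) < n j \<longrightarrow>
        inner_prod (\<mu> j) (F x) (xy_monom (t, s)) = 0) \<longleftrightarrow> M\<^sup>T *\<^sub>v x = b"
    if x: "x \<in> carrier_vec N" for x
  proof -
    have "(\<forall>j\<in>{1..r}. \<forall>t s. cantor_pair (t, s) < n j \<longrightarrow>
        inner_prod (\<mu> j) (F x) (xy_monom (t, s)) = 0) \<longleftrightarrow>
        (\<forall>z\<in>S. inner_prod (\<mu> (fst z)) (F x) (xy_monom (cantor_unpair (snd z))) = 0)"
      by (subst all_pairs_iff_all_positions) (auto simp: S_def)
    also have "\<dots> \<longleftrightarrow> (\<forall>i<N. (M\<^sup>T *\<^sub>v x) $ i - b $ i = 0)"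
      unfolding bij_betw_imp_surj_on[OF q, symmetric] ball_simps
      using orth[OF x _ prod.collapse[symmetric]] by (simp add: Ball_def)
    also have "\<dots> \<longleftrightarrow> M\<^sup>T *\<^sub>v x = b"
      using M by (auto simp del: index_mult_mat_vec simp: dim_b intro!: eq_vecI)
    finally show ?thesis .
  qed
  have "(\<exists>!P. is_type_II r \<mu> n P) \<longleftrightarrow> (\<exists>!x. x \<in> carrier_vec N \<and> M\<^sup>T *\<^sub>v x = b)"
  proof (rule ex1_iff_ex1_parameter[OF inj])
    fix P
    have monic: "(\<exists>c. P = xy_monom (cantor_unpair N) + lincomb_monoms c N) \<longleftrightarrow>
        (\<exists>x\<in>carrier_vec N. P = F x)"
    proof safe
      fix c :: "nat \<Rightarrow> real"
      show "\<exists>x\<in>carrier_vec N. xy_monom (cantor_unpair N) + lincomb_monoms c N = F x"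
        by (rule bexI[of _ "Matrix.vec N c"]) (simp_all add: F_def lincomb_monoms_eq_iff)
    qed (auto simp: F_def)
    show "is_type_II r \<mu> n P \<longleftrightarrow> (\<exists>x\<in>carrier_vec N. P = F x \<and> M\<^sup>T *\<^sub>v x = b)"
      unfolding is_type_II_def N_def[symmetric] monic using system by blast
  qed
  also have "\<dots> \<longleftrightarrow> invertible_mat M\<^sup>T"
    using M by (intro invertible_mat_iff_unique_solution[symmetric]) (auto simp: b_def)
  also have "\<dots> \<longleftrightarrow> invertible_mat M"
    by (rule invertible_mat_transpose_iff[OF M])
  finally show ?thesis
    by (simp add: M_def)
qed

text \<open>
  Here the columns carry the unknowns and each row of \<open>M\<close> is the condition for one test monomial.
  The right-hand side \<open>b\<close> is the last unit vector; for \<open>|n| = 0\<close> it is the empty vector and the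
  system has exactly one, trivial, solution, so this case is not exceptional.
\<close>

lemma type_I_unique_iff_regular:
  assumes fin: "\<And>j. j \<in> {1..r} \<Longrightarrow> finite_moments (\<mu> j)"
  shows "(\<exists>!A. is_type_I r \<mu> n A) \<longleftrightarrow> invertible_mat (block_moment_matrix r \<mu> n)"
proof -
  define N where "N = index_norm r n"
  define S where "S = Sigma {1..r} (\<lambda>j. {..<n j})"
  define M where "M = block_moment_matrix r \<mu> n"
  obtain q where q: "bij_betw q {..<N} S"
    and entry: "\<And>k i j l. k < N \<Longrightarrow> i < N \<Longrightarrow> q i = (j, l) \<Longrightarrow>
      M $$ (k, i) = moment (\<mu> j) (cantor_unpair k + cantor_unpair l)"
    using block_moment_matrix_columns[of r n \<mu>] unfolding N_def S_def M_def by blast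
  have M: "M \<in> carrier_mat N N"
    unfolding M_def N_def by (rule block_moment_matrix_carrier)
  define p where "p = inv_into {..<N} q"
  have p: "bij_betw p S {..<N}"
    unfolding p_def by (rule bij_betw_inv_into[OF q])
  have p_less: "p z < N" and q_p: "q (p z) = z" if "z \<in> S" for z
    using that bij_betwE[OF p] bij_betw_inv_into_right[OF q] by (auto simp: p_def)
  define b :: "real Matrix.vec" where "b = Matrix.vec N (\<lambda>k. if k + 1 = N then 1 else 0)"
  have dim_b: "dim_vec b = N"
    by (simp add: b_def)
  \<comment> \<open>Outside \<open>{1..r}\<close> the family must take the default value for \<open>extensional\<close>, hence the
    restricted abstraction.\<close>
  define F where "F x = (\<lambda>j\<in>{1..r}. lincomb_monoms (\<lambda>l. x $ p (j, l)) (n j))"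
    for x :: "real Matrix.vec"
  have inj: "inj_on F (carrier_vec N)"
  proof (intro inj_onI eq_vecI)
    fix x y i
    assume "x \<in> carrier_vec N" and y: "y \<in> carrier_vec N" and eq: "F x = F y" and "i < dim_vec y"
    then have "i \<in> p ` S"
      using bij_betw_imp_surj_on[OF p] by simp
    then obtain j l where jl: "j \<in> {1..r}" "l < n j" "i = p (j, l)"
      by (auto simp: S_def)
    have "F x j = F y j"
      by (simp add: eq)
    then show "x $ i = y $ i"
      using jl by (simp add: F_def lincomb_monoms_eq_iff)
  qed auto
  have pairing: "(\<Sum>j=1..r. inner_prod (\<mu> j) (F x j) (xy_monom (cantor_unpair k))) = (M *\<^sub>v x) $ k"
    if x: "x \<in> carrier_vec N" and k: "k < N" for x k
  proof -
    have "(\<Sum>j=1..r. inner_prod (\<mu> j) (F x j) (xy_monom (cantor_unpair k))) =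
        (\<Sum>j=1..r. \<Sum>l<n j. x $ p (j, l) * moment (\<mu> j) (cantor_unpair k + cantor_unpair l))"
      by (intro sum.cong) (simp_all add: F_def inner_prod_lincomb_monoms fin add.commute)
    also have "\<dots> = (\<Sum>z\<in>S. M $$ (k, p z) * x $ p z)"
      unfolding S_def
      by (subst sum.Sigma) (auto simp: entry[OF k p_less q_p] S_def intro!: sum.cong)
    also have "\<dots> = (\<Sum>i<N. M $$ (k, i) * x $ i)"
      by (rule sum.reindex_bij_betw[OF p])
    also have "\<dots> = (M *\<^sub>v x) $ k"
      using x k M by (auto simp: scalar_prod_def atLeast0LessThan intro!: sum.cong)
    finally show ?thesis .
  qed
  have system: "(\<forall>t s.
        (cantor_pair (t, s) + 2 \<le> N \<longrightarrow>
           (\<Sum>j=1..r. inner_prod (\<mu> j) (F x j) (xy_monom (t, s))) = 0) \<and>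
        (cantor_pair (t, s) + 1 = N \<longrightarrow>
           (\<Sum>j=1..r. inner_prod (\<mu> j) (F x j) (xy_monom (t, s))) = 1)) \<longleftrightarrow> M *\<^sub>v x = b"
    (is "?L \<longleftrightarrow> _")
    if x: "x \<in> carrier_vec N" for x
  proof -
    let ?s = "\<lambda>k. \<Sum>j=1..r. inner_prod (\<mu> j) (F x j) (xy_monom (cantor_unpair k))"
    have "?L \<longleftrightarrow> (\<forall>k. (k + 2 \<le> N \<longrightarrow> ?s k = 0) \<and> (k + 1 = N \<longrightarrow> ?s k = 1))"
      by (rule all_pairs_iff_all_positions)
    also have "\<dots> \<longleftrightarrow> (\<forall>k<N. ?s k = (if k + 1 = N then 1 else 0))"
    proof -
      have "(k + 2 \<le> N \<longrightarrow> a = 0) \<and> (k + 1 = N \<longrightarrow> a = 1) \<longleftrightarrow>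
          (k < N \<longrightarrow> a = (if k + 1 = N then 1 else 0))" for k and a :: real
        by (cases "k + 1 = N") auto
      then show ?thesis
        by presburger
    qed
    also have "\<dots> \<longleftrightarrow> (\<forall>k<N. (M *\<^sub>v x) $ k = b $ k)"
      using pairing[OF x] by (simp add: b_def)
    also have "\<dots> \<longleftrightarrow> M *\<^sub>v x = b"
      using M by (auto simp del: index_mult_mat_vec simp: dim_b intro!: eq_vecI)
    finally show ?thesis .
  qed
  have "(\<exists>!A. is_type_I r \<mu> n A) \<longleftrightarrow> (\<exists>!x. x \<in> carrier_vec N \<and> M *\<^sub>v x = b)"
  proof (rule ex1_iff_ex1_parameter[OF inj])
    fix A
    have shape: "A \<in> extensional {1..r} \<and> (\<forall>j\<in>{1..r}. \<exists>c. A j = lincomb_monoms c (n j)) \<longleftrightarrow>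
        (\<exists>x\<in>carrier_vec N. A = F x)"
    proof
      assume A: "A \<in> extensional {1..r} \<and> (\<forall>j\<in>{1..r}. \<exists>c. A j = lincomb_monoms c (n j))"
      then obtain c where c: "\<And>j. j \<in> {1..r} \<Longrightarrow> A j = lincomb_monoms (c j) (n j)"
        by metis
      define x where "x = Matrix.vec N (\<lambda>i. case q i of (j, l) \<Rightarrow> c j l)"
      have "x $ p (j, l) = c j l" if "j \<in> {1..r}" "l < n j" for j l
        using that p_less q_p by (simp add: x_def S_def)
      then have "A = F x"
        using A c by (intro extensionalityI[of A "{1..r}"]) (auto simp: F_def lincomb_monoms_eq_iff)
      then show "\<exists>x\<in>carrier_vec N. A = F x"
        by (intro bexI[of _ x]) (simp_all add: x_def)
    qed (auto simp: F_def)
    show "is_type_I r \<mu> n A \<longleftrightarrow> (\<exists>x\<in>carrier_vec N. A = F x \<and> M *\<^sub>v x = b)"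
      unfolding is_type_I_def N_def[symmetric] conj_assoc[symmetric] shape using system by auto
  qed
  also have "\<dots> \<longleftrightarrow> invertible_mat M"
    using M by (intro invertible_mat_iff_unique_solution[symmetric]) (auto simp: b_def)
  finally show ?thesis
    by (simp add: M_def)
qed

section \<open>The equivalence\<close>

theorem proposition4p1:
  fixes r :: nat
    and \<mu> :: "nat \<Rightarrow> (real \<times> real) measure"
    and n :: "nat \<Rightarrow> nat"
  assumes "\<And>j. j \<in> {1..r} \<Longrightarrow> sets (\<mu> j) = sets borel"
    and "\<And>j. j \<in> {1..r} \<Longrightarrow> finite_moments (\<mu> j)"
  shows "((\<exists>!A. is_type_I r \<mu> n A) \<longleftrightarrow> (\<exists>!P. is_type_II r \<mu> n P)) \<and>
         ((\<exists>!P. is_type_II r \<mu> n P) \<longleftrightarrow> invertible_mat (block_moment_matrix r \<mu> n))"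
  by (simp only: type_I_unique_iff_regular[OF assms(2)] type_II_unique_iff_regular[OF assms(2)])

end
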